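(* Let $V$ and $F$ be Banach spaces and $U\subset V$ open. A map $f:U\to F$ is $C^1_F$-smooth if and only if there exists a continuous map $D_f:U\to L_c(V,F)$ such that for every $u\in U$ the following holds: for every $\epsilon>0$ there exists $\delta>0$ with $$|f(v)-f(u)-D_f(u)(v-u)|\le\epsilon|v-u|\quad\text{for all } v\in U\text{ with }|v-u|<\delta.$$ In this case, $D_f(u)v$ is the directional derivative $Df(u)v$, for every $u\in U$, $v\in V$.
   Context: For topological vector spaces $V,W$, $L_c(V,W)$ denotes the vector space of continuous linear maps $V\to W$; the topology $\beta$ on $L_c(V,W)$ is that of uniform convergence on bounded sets (basic neighbourhoods of $0$: $\{A\in L_c(V,W): AB\subset N\}$ with $B\subset V$ bounded and $N$ a neighbourhood of $0$ in $W$). For Banach spaces $\beta$ is the norm topology given by $|A|=\sup_{|v|\le1}|Av|$. A continuous map $f:V\supset U\to W$, $U$ open, is $C^1_F$-smooth if all directional derivatives $Df(u)v=\lim_{0\ne t\to0}\frac1t(f(u+tv)-f(u))$, $u\in U$, $v\in V$, exist, each $Df(u):V\to W$ is linear and continuous, and $U\ni u\mapsto Df(u)\in L_c(V,W)$ is continuous with respect to $\beta$. *)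

theory Defs
  imports "HOL-Analysis.Analysis"
begin

text \<open>Scalars are real. The definitions use only the vector space structure and the topology of the
  types involved; they are meant for topological vector spaces.\<close>

definition cont_linear_maps ::
    "('v::{real_vector,topological_space} \<Rightarrow> 'w::{real_vector,topological_space}) set" where
  "cont_linear_maps = {A. linear A \<and> continuous_on UNIV A}"

text \<open>Bounded in the sense of topological vector spaces: absorbed by every neighbourhood of \<open>0\<close>.\<close>

definition tvs_bounded :: "'v::{real_vector,topological_space} set \<Rightarrow> bool" where
  "tvs_bounded B \<longleftrightarrow> (\<forall>N. open N \<and> 0 \<in> N \<longrightarrow> (\<exists>s>0. \<forall>t>s. B \<subseteq> (\<lambda>x. t *\<^sub>R x) ` N))"

text \<open>The topology \<open>\<beta>\<close>. Its neighbourhood filter at \<open>A\<close> is generated by the translates \<open>A + {C. C ` B \<subseteq> N}\<close>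
  of the basic neighbourhoods of \<open>0\<close>.\<close>

definition beta_open ::
    "('v::{real_vector,topological_space} \<Rightarrow> 'w::{real_vector,topological_space}) set \<Rightarrow> bool" where
  "beta_open S \<longleftrightarrow> S \<subseteq> cont_linear_maps \<and>
     (\<forall>A\<in>S. \<exists>B N. tvs_bounded B \<and> open N \<and> 0 \<in> N \<and>
        {A' \<in> cont_linear_maps. (\<lambda>x. A' x - A x) ` B \<subseteq> N} \<subseteq> S)"

definition beta_topology ::
    "('v::{real_vector,topological_space} \<Rightarrow> 'w::{real_vector,topological_space}) topology" where
  "beta_topology = topology beta_open"

lemma tvs_bounded_Un:
  assumes "tvs_bounded B" "tvs_bounded C"
  shows "tvs_bounded (B \<union> C)"
  unfolding tvs_bounded_def
proof (intro allI impI)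
  fix N :: "'a set"
  assume N: "open N \<and> 0 \<in> N"
  obtain s where s: "s > 0" "\<forall>t>s. B \<subseteq> (\<lambda>x. t *\<^sub>R x) ` N"
    using assms(1) N unfolding tvs_bounded_def by blast
  obtain r where r: "r > 0" "\<forall>t>r. C \<subseteq> (\<lambda>x. t *\<^sub>R x) ` N"
    using assms(2) N unfolding tvs_bounded_def by blast
  show "\<exists>s>0. \<forall>t>s. B \<union> C \<subseteq> (\<lambda>x. t *\<^sub>R x) ` N"
    using s r by (intro exI[of _ "max s r"]) auto
qed

lemma istopology_beta_open: "istopology beta_open"
  unfolding istopology_def
proof (intro conjI allI impI)
  fix S T :: "('a \<Rightarrow> 'b) set"
  assume S: "beta_open S" and T: "beta_open T"
  show "beta_open (S \<inter> T)"
    unfolding beta_open_def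
  proof (intro conjI ballI)
    show "S \<inter> T \<subseteq> cont_linear_maps" using S unfolding beta_open_def by blast
    fix A assume A: "A \<in> S \<inter> T"
    obtain B N where 1: "tvs_bounded B" "open N" "0 \<in> N"
      "{A' \<in> cont_linear_maps. (\<lambda>x. A' x - A x) ` B \<subseteq> N} \<subseteq> S"
      using S A unfolding beta_open_def by blast
    obtain C M where 2: "tvs_bounded C" "open M" "0 \<in> M"
      "{A' \<in> cont_linear_maps. (\<lambda>x. A' x - A x) ` C \<subseteq> M} \<subseteq> T"
      using T A unfolding beta_open_def by blast
    have "{A' \<in> cont_linear_maps. (\<lambda>x. A' x - A x) ` (B \<union> C) \<subseteq> N \<inter> M} \<subseteq> S \<inter> T"
    proof
      fix A'
      assume "A' \<in> {A' \<in> cont_linear_maps. (\<lambda>x. A' x - A x) ` (B \<union> C) \<subseteq> N \<inter> M}"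
      then have "A' \<in> cont_linear_maps" "(\<lambda>x. A' x - A x) ` B \<subseteq> N" "(\<lambda>x. A' x - A x) ` C \<subseteq> M"
        by auto
      then show "A' \<in> S \<inter> T" using 1(4) 2(4) by auto
    qed
    moreover have "tvs_bounded (B \<union> C)" "open (N \<inter> M)" "0 \<in> N \<inter> M"
      using 1 2 by (auto intro: tvs_bounded_Un)
    ultimately show "\<exists>B N. tvs_bounded B \<and> open N \<and> 0 \<in> N \<and>
        {A' \<in> cont_linear_maps. (\<lambda>x. A' x - A x) ` B \<subseteq> N} \<subseteq> S \<inter> T"
      by blast
  qed
next
  fix K :: "('a \<Rightarrow> 'b) set set"
  assume K: "\<forall>S\<in>K. beta_open S"
  show "beta_open (\<Union>K)"
    unfolding beta_open_def
  proof (intro conjI ballI)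
    show "\<Union>K \<subseteq> cont_linear_maps" using K unfolding beta_open_def by blast
    fix A assume "A \<in> \<Union>K"
    then obtain S where S: "S \<in> K" "A \<in> S" by blast
    then have "beta_open S" using K by simp
    with S(2) have "\<exists>B N. tvs_bounded B \<and> open N \<and> 0 \<in> N \<and>
        {A' \<in> cont_linear_maps. (\<lambda>x. A' x - A x) ` B \<subseteq> N} \<subseteq> S"
      by (simp add: beta_open_def)
    moreover have "S \<subseteq> \<Union>K" using S(1) by (rule Union_upper)
    ultimately show "\<exists>B N. tvs_bounded B \<and> open N \<and> 0 \<in> N \<and>
        {A' \<in> cont_linear_maps. (\<lambda>x. A' x - A x) ` B \<subseteq> N} \<subseteq> \<Union>K"
      by (elim exE conjE) (intro exI conjI, assumption+, erule order_trans)
  qed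
qed

lemma openin_beta_topology: "openin beta_topology S \<longleftrightarrow> beta_open S"
  by (simp add: beta_topology_def istopology_beta_open)

lemma topspace_beta_topology: "topspace beta_topology = cont_linear_maps"
proof -
  have "tvs_bounded {}" by (auto simp: tvs_bounded_def intro: exI[of _ 1])
  then have "beta_open (cont_linear_maps :: ('a \<Rightarrow> 'b) set)"
    unfolding beta_open_def by (intro conjI ballI exI[of _ "{}"] exI[of _ UNIV]) auto
  then show ?thesis
    unfolding topspace_def openin_beta_topology by (auto simp: beta_open_def)
qed

definition has_dir_deriv ::
    "('v::{real_vector,topological_space} \<Rightarrow> 'w::{real_vector,t2_space}) \<Rightarrow> 'v \<Rightarrow> 'v \<Rightarrow> 'w \<Rightarrow> bool" where
  "has_dir_deriv f u v w \<longleftrightarrow> ((\<lambda>t::real. (1 / t) *\<^sub>R (f (u + t *\<^sub>R v) - f u)) \<longlongrightarrow> w) (at 0)"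

definition dir_deriv ::
    "('v::{real_vector,topological_space} \<Rightarrow> 'w::{real_vector,t2_space}) \<Rightarrow> 'v \<Rightarrow> 'v \<Rightarrow> 'w" where
  "dir_deriv f u v = Lim (at 0) (\<lambda>t::real. (1 / t) *\<^sub>R (f (u + t *\<^sub>R v) - f u))"

text \<open>A map \<open>f : U \<rightarrow> W\<close> is given by a total function; as \<open>U\<close> is open, its values outside \<open>U\<close> are
  irrelevant.\<close>

definition C1F_smooth_on ::
    "'v::{real_vector,topological_space} set \<Rightarrow> ('v \<Rightarrow> 'w::{real_vector,t2_space}) \<Rightarrow> bool" where
  "C1F_smooth_on U f \<longleftrightarrow> continuous_on U f \<and>
     (\<forall>u\<in>U. \<forall>v. \<exists>w. has_dir_deriv f u v w) \<and>
     (\<forall>u\<in>U. dir_deriv f u \<in> cont_linear_maps) \<and>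
     continuous_map (top_of_set U) beta_topology (dir_deriv f)"

definition cont_derivative_on ::
    "'v::real_normed_vector set \<Rightarrow> ('v \<Rightarrow> 'f::real_normed_vector) \<Rightarrow> ('v \<Rightarrow> 'v \<Rightarrow> 'f) \<Rightarrow> bool" where
  "cont_derivative_on U f D \<longleftrightarrow>
     (\<forall>u\<in>U. D u \<in> cont_linear_maps) \<and>
     continuous_map (top_of_set U) beta_topology D \<and>
     (\<forall>u\<in>U. \<forall>\<epsilon>>0. \<exists>\<delta>>0. \<forall>v\<in>U. norm (v - u) < \<delta> \<longrightarrow>
        norm (f v - f u - D u (v - u)) \<le> \<epsilon> * norm (v - u))"

end

theory Submission
  imports Defs
begin

text \<open>On normed spaces the unit ball is bounded, so \<open>\<beta>\<close>-continuity of a family of operators is at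
  least continuity in the operator norm. If \<open>f\<close> is smooth with directional derivative \<open>D\<close>, then for
  \<open>u + h\<close> near \<open>u\<close> the curve \<open>t \<mapsto> f (u + t h) - t D u h\<close>, \<open>0 \<le> t \<le> 1\<close>, has derivative
  \<open>(D (u + t h) - D u) h\<close>, of norm at most \<open>\<epsilon> |h|\<close>; the mean value inequality turns this into the
  Frechet estimate. Conversely, the chain rule along lines recovers the directional derivatives from
  the Frechet derivative.\<close>

text \<open>Continuity at 0 bounds \<open>A\<close> on some ball around 0, and homogeneity spreads
  this bound to all vectors. This opens \<open>cont_linear_maps\<close> to the \<open>onorm\<close>
  calculus.\<close>

lemma cont_linear_maps_iff_bounded_linear:
  fixes A :: "'v::real_normed_vector \<Rightarrow> 'w::real_normed_vector"
  shows "A \<in> cont_linear_maps \<longleftrightarrow> bounded_linear A"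
proof
  assume "A \<in> cont_linear_maps"
  then have lin: "linear A" and "isCont A 0"
    by (auto simp: cont_linear_maps_def continuous_on_eq_continuous_at)
  then obtain d where d: "d > 0" and *: "\<And>x. norm x < d \<Longrightarrow> norm (A x) < 1"
    unfolding continuous_at_eps_delta
    by (metis diff_zero dist_norm linear_0 zero_less_one)
  show "bounded_linear A"
  proof (rule bounded_linear_intro[where K = "2 / d"])
    fix x :: 'v
    show "norm (A x) \<le> norm x * (2 / d)"
    proof (cases "x = 0")
      case False
      \<comment> \<open>This factor scales \<open>x\<close> to norm \<open>d / 2\<close>, strictly
        inside the ball where \<open>A\<close> stays below 1; hence the constant
        \<open>2 / d\<close>.\<close>
      let ?c = "d / (2 * norm x)"
      have c: "?c > 0" using d False by simp
      have "norm (?c *\<^sub>R x) < d" using d False by simp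
      then have "norm (A (?c *\<^sub>R x)) < 1" by (rule *)
      then have "?c * norm (A x) < 1" using c d by (simp add: linear_scale[OF lin])
      then show ?thesis using d False by (simp add: field_simps)
    qed (simp add: linear_0[OF lin])
  qed (simp_all add: linear_add[OF lin] linear_scale[OF lin])
qed (simp add: cont_linear_maps_def bounded_linear.linear linear_continuous_on)

lemma tvs_bounded_cball: "tvs_bounded (cball (0::'v::real_normed_vector) r)"
  unfolding tvs_bounded_def
proof (intro allI impI)
  fix N :: "'v set"
  assume N: "open N \<and> 0 \<in> N"
  then obtain d where d: "d > 0" "ball 0 d \<subseteq> N" by (meson openE)
  \<comment> \<open>Taking \<open>\<bar>r\<bar> + 1\<close> instead of \<open>r\<close> keeps
    \<open>s\<close> positive for every real \<open>r\<close> and turns the closed-ball bound into a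
    strict one.\<close>
  define s where "s = (\<bar>r\<bar> + 1) / d"
  have s: "s > 0" using d by (simp add: s_def)
  have "cball 0 r \<subseteq> (\<lambda>x. t *\<^sub>R x) ` N" if t: "t > s" for t
  proof
    fix x :: 'v
    assume "x \<in> cball 0 r"
    then have "norm x < \<bar>r\<bar> + 1" by simp
    also have "\<dots> < t * d" using t d by (simp add: s_def field_simps)
    finally have "norm ((1 / t) *\<^sub>R x) < d" using s t by (simp add: field_simps)
    then have "(1 / t) *\<^sub>R x \<in> N" using d by auto
    moreover have "x = t *\<^sub>R ((1 / t) *\<^sub>R x)" using s t by simp
    ultimately show "x \<in> (\<lambda>x. t *\<^sub>R x) ` N" by blast
  qed
  then show "\<exists>s>0. \<forall>t>s. cball 0 r \<subseteq> (\<lambda>x. t *\<^sub>R x) ` N" using s by blast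
qed

text \<open>A map uniformly small on the closed unit ball has small operator norm. So around each
  point of an operator-norm ball, a basic \<beta>-neighbourhood with \<open>B = cball 0 1\<close>
  fits inside.\<close>

lemma openin_beta_onorm_ball:
  fixes A :: "'v::real_normed_vector \<Rightarrow> 'w::real_normed_vector"
  assumes A: "bounded_linear A"
  shows "openin beta_topology {A' \<in> cont_linear_maps. onorm (\<lambda>x. A' x - A x) < e}"
  unfolding openin_beta_topology beta_open_def
proof (intro conjI ballI)
  fix A' :: "'v \<Rightarrow> 'w"
  assume "A' \<in> {A' \<in> cont_linear_maps. onorm (\<lambda>x. A' x - A x) < e}"
  then have A': "bounded_linear A'" and less: "onorm (\<lambda>x. A' x - A x) < e"
    by (auto simp: cont_linear_maps_iff_bounded_linear)
  \<comment> \<open>Half the slack at \<open>A'\<close>: the supremum over the unit ball yields only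
    \<open>\<le> r\<close>, and halving keeps the final inequality strict.\<close>
  define r where "r = (e - onorm (\<lambda>x. A' x - A x)) / 2"
  have r: "r > 0" using less by (simp add: r_def)
  have "onorm (\<lambda>x. C x - A x) < e"
    if C: "bounded_linear C" and sub: "(\<lambda>x. C x - A' x) ` cball 0 1 \<subseteq> ball 0 r" for C
  proof -
    have bl: "bounded_linear (\<lambda>x. C x - A' x)" "bounded_linear (\<lambda>x. A' x - A x)"
      using A A' C by (auto intro: bounded_linear_sub)
    have "onorm (\<lambda>x. C x - A' x) \<le> r"
    proof (rule onorm_bound)
      fix x
      show "norm (C x - A' x) \<le> r * norm x"
      proof (cases "x = 0")
        case True
        then show ?thesis by (simp add: linear_0[OF bounded_linear.linear] C A')
      next
        case False
        let ?y = "(1 / norm x) *\<^sub>R x"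
        have "?y \<in> cball 0 1" using False by simp
        then have "norm (C ?y - A' ?y) < r" using sub by (auto simp: image_subset_iff)
        also have "C ?y - A' ?y = (1 / norm x) *\<^sub>R (C x - A' x)"
          by (simp add: linear_scale[OF bounded_linear.linear] C A' scaleR_diff_right)
        finally have "norm (C x - A' x) / norm x < r" by simp
        then show ?thesis using False by (simp add: divide_simps split: if_splits)
      qed
    qed (use r in simp)
    moreover have "onorm (\<lambda>x. (C x - A' x) + (A' x - A x))
        \<le> onorm (\<lambda>x. C x - A' x) + onorm (\<lambda>x. A' x - A x)"
      by (rule onorm_triangle[OF bl])
    ultimately show ?thesis using r by (simp add: r_def field_simps)
  qed
  then have "{C \<in> cont_linear_maps. (\<lambda>x. C x - A' x) ` cball 0 1 \<subseteq> ball 0 r}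
      \<subseteq> {A' \<in> cont_linear_maps. onorm (\<lambda>x. A' x - A x) < e}"
    by (auto simp: cont_linear_maps_iff_bounded_linear)
  then show "\<exists>B N. tvs_bounded B \<and> open N \<and> 0 \<in> N \<and>
      {C \<in> cont_linear_maps. (\<lambda>x. C x - A' x) ` B \<subseteq> N}
      \<subseteq> {A' \<in> cont_linear_maps. onorm (\<lambda>x. A' x - A x) < e}"
    using r by (intro exI[of _ "cball 0 1"] exI[of _ "ball 0 r"]) (simp add: tvs_bounded_cball)
qed blast

text \<open>Pulling back an operator-norm ball around \<open>D u\<close> gives a set open in
  \<open>U\<close>, hence open. The ball of radius \<open>d\<close> is placed inside
  \<open>U\<close> so that segments from \<open>u\<close> remain in the domain.\<close>

lemma continuous_map_beta_onorm:
  fixes D :: "'u::real_normed_vector \<Rightarrow> 'v::real_normed_vector \<Rightarrow> 'w::real_normed_vector"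
  assumes cont: "continuous_map (top_of_set U) beta_topology D"
    and U: "open U" "u \<in> U" and e: "e > 0"
  obtains d where "d > 0" "ball u d \<subseteq> U" "\<And>v. v \<in> ball u d \<Longrightarrow> onorm (\<lambda>x. D v x - D u x) < e"
proof -
  let ?S = "{A' \<in> cont_linear_maps. onorm (\<lambda>x. A' x - D u x) < e}"
  have Du: "D u \<in> cont_linear_maps"
    using continuous_map_image_subset_topspace[OF cont] U by (auto simp: topspace_beta_topology)
  then have "openin beta_topology ?S"
    by (intro openin_beta_onorm_ball) (simp add: cont_linear_maps_iff_bounded_linear)
  from openin_continuous_map_preimage[OF cont this] have "open {v \<in> U. D v \<in> ?S}"
    using U openin_open_eq by fastforce
  moreover have "u \<in> {v \<in> U. D v \<in> ?S}" using U Du e by (simp add: onorm_zero)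
  ultimately obtain d where "d > 0" "ball u d \<subseteq> {v \<in> U. D v \<in> ?S}" by (meson openE)
  then show thesis by (intro that[of d]) auto
qed

text \<open>Both sides are the same limit, once as a remainder divided by \<open>norm t\<close> and
  once as a difference quotient minus \<open>w\<close>. A general parameter \<open>s\<close> allows
  differentiation along a whole segment; \<open>s = 0\<close> is the case at \<open>u\<close>
  itself.\<close>

lemma has_dir_deriv_iff_has_vector_derivative:
  fixes f :: "'v::real_normed_vector \<Rightarrow> 'w::real_normed_vector"
  shows "has_dir_deriv f (u + s *\<^sub>R v) v w \<longleftrightarrow>
    ((\<lambda>t. f (u + t *\<^sub>R v)) has_vector_derivative w) (at s)"
proof -
  have *: "norm (f (u + (s + t) *\<^sub>R v) - f (u + s *\<^sub>R v) - t *\<^sub>R w) / norm t =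
      norm ((1 / t) *\<^sub>R (f (u + s *\<^sub>R v + t *\<^sub>R v) - f (u + s *\<^sub>R v)) - w)" if "t \<noteq> 0" for t :: real
  proof -
    have "(1 / t) *\<^sub>R (f (u + s *\<^sub>R v + t *\<^sub>R v) - f (u + s *\<^sub>R v)) - w =
        (1 / t) *\<^sub>R (f (u + (s + t) *\<^sub>R v) - f (u + s *\<^sub>R v) - t *\<^sub>R w)"
      using that by (simp add: algebra_simps)
    then show ?thesis by (simp add: divide_simps)
  qed
  have "((\<lambda>t. f (u + t *\<^sub>R v)) has_vector_derivative w) (at s) \<longleftrightarrow>
      (\<lambda>t. norm (f (u + (s + t) *\<^sub>R v) - f (u + s *\<^sub>R v) - t *\<^sub>R w) / norm t) \<midarrow>0\<rightarrow> 0"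
    by (simp add: has_vector_derivative_def has_derivative_at bounded_linear_scaleR_left)
  also have "\<dots> \<longleftrightarrow>
      (\<lambda>t. norm ((1 / t) *\<^sub>R (f (u + s *\<^sub>R v + t *\<^sub>R v) - f (u + s *\<^sub>R v)) - w)) \<midarrow>0\<rightarrow> 0"
    by (rule LIM_cong) (use * in auto)
  also have "\<dots> \<longleftrightarrow> has_dir_deriv f (u + s *\<^sub>R v) v w"
    unfolding has_dir_deriv_def tendsto_norm_zero_iff by (rule LIM_zero_iff)
  finally show ?thesis by simp
qed

lemma dir_deriv_eqI: "has_dir_deriv f u v w \<Longrightarrow> dir_deriv f u v = w"
  unfolding has_dir_deriv_def dir_deriv_def by (intro tendsto_Lim) auto

lemma has_derivative_imp_has_dir_deriv:
  fixes f :: "'v::real_normed_vector \<Rightarrow> 'w::real_normed_vector"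
  assumes "(f has_derivative f') (at u)"
  shows "has_dir_deriv f u v (f' v)"
proof -
  have f': "linear f'" using assms by (rule has_derivative_linear)
  have "((\<lambda>t. u + t *\<^sub>R v) has_derivative (\<lambda>t. t *\<^sub>R v)) (at (0::real))"
    by (auto intro!: derivative_eq_intros)
  \<comment> \<open>The base point is written as the value of the line at 0, the form the chain rule
    expects.\<close>
  moreover have "(f has_derivative f') (at (u + (0::real) *\<^sub>R v))" using assms by simp
  ultimately have "((\<lambda>t. f (u + t *\<^sub>R v)) has_derivative (\<lambda>t. f' (t *\<^sub>R v))) (at (0::real))"
    by (rule has_derivative_compose)
  then have "((\<lambda>t. f (u + t *\<^sub>R v)) has_vector_derivative f' v) (at 0)"
    by (simp add: has_vector_derivative_def linear_scale[OF f'])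
  then show ?thesis
    using has_dir_deriv_iff_has_vector_derivative[of f u 0 v "f' v"] by simp
qed

text \<open>The estimate over \<open>v \<in> U\<close> is differentiability within \<open>U\<close>,
  and at a point of an open set this is full differentiability.\<close>

lemma cont_derivative_on_has_derivative:
  assumes D: "cont_derivative_on U f D" and U: "open U" "u \<in> U"
  shows "(f has_derivative D u) (at u)"
proof -
  have "(f has_derivative D u) (at u within U)"
    unfolding has_derivative_within_alt
    using D U by (auto simp: cont_derivative_on_def cont_linear_maps_iff_bounded_linear)
  then show ?thesis using U by (simp add: at_within_open[of u U])
qed

lemma cont_derivative_on_has_dir_deriv:
  assumes "cont_derivative_on U f D" "open U" "u \<in> U"
  shows "has_dir_deriv f u v (D u v)"
  using assms by (intro has_derivative_imp_has_dir_deriv cont_derivative_on_has_derivative)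

lemma cont_derivative_on_imp_C1F_smooth_on:
  assumes D: "cont_derivative_on U f D" and U: "open U"
  shows "C1F_smooth_on U f"
proof -
  have eq: "dir_deriv f u = D u" if "u \<in> U" for u
    using cont_derivative_on_has_dir_deriv[OF D U that] by (intro ext dir_deriv_eqI)
  have "continuous_on U f"
    using cont_derivative_on_has_derivative[OF D U]
    by (meson continuous_at_imp_continuous_on has_derivative_continuous)
  \<comment> \<open>The equality \<open>eq\<close> holds at points of \<open>U\<close>, which is the
    whole space of \<open>top_of_set U\<close>, so continuity passes from \<open>D\<close> to
    \<open>dir_deriv f\<close>.\<close>
  moreover have "continuous_map (top_of_set U) beta_topology (dir_deriv f)"
    by (rule continuous_map_eq[of _ _ D]) (use D eq in \<open>auto simp: cont_derivative_on_def\<close>)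
  ultimately show ?thesis
    unfolding C1F_smooth_on_def
    using D eq cont_derivative_on_has_dir_deriv[OF D U] by (auto simp: cont_derivative_on_def)
qed

lemma C1F_smooth_on_imp_cont_derivative_on:
  fixes f :: "'v::real_normed_vector \<Rightarrow> 'w::real_normed_vector"
  assumes f: "C1F_smooth_on U f" and U: "open U"
  shows "cont_derivative_on U f (dir_deriv f)"
proof -
  let ?D = "dir_deriv f"
  have cont: "continuous_map (top_of_set U) beta_topology ?D"
    and bl: "\<And>u. u \<in> U \<Longrightarrow> bounded_linear (?D u)"
    using f by (auto simp: C1F_smooth_on_def cont_linear_maps_iff_bounded_linear)
  have dir: "has_dir_deriv f u v (?D u v)" if "u \<in> U" for u v
  proof -
    from f that obtain w where "has_dir_deriv f u v w" unfolding C1F_smooth_on_def by blast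
    then show ?thesis by (simp add: dir_deriv_eqI)
  qed
  have "\<exists>\<delta>>0. \<forall>v\<in>U. norm (v - u) < \<delta> \<longrightarrow> norm (f v - f u - ?D u (v - u)) \<le> e * norm (v - u)"
    if u: "u \<in> U" and e: "e > 0" for u e
  proof -
    obtain d where d: "d > 0" "ball u d \<subseteq> U"
      and on: "\<And>v. v \<in> ball u d \<Longrightarrow> onorm (\<lambda>x. ?D v x - ?D u x) < e"
      using continuous_map_beta_onorm[OF cont U u e] by metis
    have "norm (f v - f u - ?D u (v - u)) \<le> e * norm (v - u)" if v: "norm (v - u) < d" for v
    proof -
      define h where "h = v - u"
      \<comment> \<open>The linear correction makes \<open>g 1 - g 0\<close> exactly the Frechet
        remainder at \<open>v\<close>.\<close>
      define g where "g = (\<lambda>t::real. f (u + t *\<^sub>R h) - t *\<^sub>R ?D u h)"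
      define g' where "g' = (\<lambda>t::real. ?D (u + t *\<^sub>R h) h - ?D u h)"
      have seg: "u + t *\<^sub>R h \<in> ball u d" if "t \<in> {0..1}" for t :: real
      proof -
        have "\<bar>t\<bar> * norm h \<le> 1 * norm h" using that by (intro mult_right_mono) auto
        then show ?thesis using v by (simp add: dist_norm h_def)
      qed
      have "norm (g 1 - g 0) \<le> e * norm h * norm (1 - 0 :: real)"
      \<comment> \<open>The derivative of a curve is viewed as the linear map sending
        \<open>s\<close> to \<open>s *\<^sub>R g' t\<close>; a bound on \<open>norm (g' t)\<close>
        then bounds its operator norm.\<close>
      proof (rule differentiable_bound[where S = "{0..1}" and f' = "\<lambda>t s. s *\<^sub>R g' t"])
        fix t :: real
        assume t: "t \<in> {0..1}"
        have inU: "u + t *\<^sub>R h \<in> U" using seg[OF t] d by blast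
        then have "((\<lambda>t. f (u + t *\<^sub>R h)) has_vector_derivative ?D (u + t *\<^sub>R h) h) (at t)"
          using dir has_dir_deriv_iff_has_vector_derivative by blast
        then have "(g has_vector_derivative g' t) (at t)"
          unfolding g_def g'_def by (auto intro!: derivative_eq_intros)
        then show "(g has_derivative (\<lambda>s. s *\<^sub>R g' t)) (at t within {0..1})"
          unfolding has_vector_derivative_def by (rule has_derivative_at_withinI)
        have "norm (g' t) \<le> onorm (\<lambda>x. ?D (u + t *\<^sub>R h) x - ?D u x) * norm h"
          unfolding g'_def using bl inU u by (intro onorm bounded_linear_sub)
        also have "\<dots> \<le> e * norm h" using on[OF seg[OF t]] by (intro mult_right_mono) auto
        finally have "norm (g' t) \<le> e * norm h" .
        then show "onorm (\<lambda>s. s *\<^sub>R g' t) \<le> e * norm h"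
          using e by (intro onorm_bound) (auto simp: mult.commute intro: mult_left_mono)
      qed auto
      then show ?thesis by (simp add: g_def h_def algebra_simps)
    qed
    then show ?thesis using d by blast
  qed
  then show ?thesis using f cont unfolding cont_derivative_on_def C1F_smooth_on_def by blast
qed

theorem proposition3p4:
  fixes U :: "'v::banach set" and f :: "'v \<Rightarrow> 'f::banach"
  assumes "open U"
  shows "(C1F_smooth_on U f \<longleftrightarrow> (\<exists>D. cont_derivative_on U f D)) \<and>
    (\<forall>D. cont_derivative_on U f D \<longrightarrow>
      (\<forall>u\<in>U. \<forall>v. has_dir_deriv f u v (D u v) \<and> D u v = dir_deriv f u v))"
proof (intro conjI iffI allI impI ballI)
  show "\<exists>D. cont_derivative_on U f D" if "C1F_smooth_on U f"
    using C1F_smooth_on_imp_cont_derivative_on[OF that assms] by blast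
  show "C1F_smooth_on U f" if "\<exists>D. cont_derivative_on U f D"
    using that cont_derivative_on_imp_C1F_smooth_on[OF _ assms] by blast
  \<comment> \<open>Here \<open>D\<close> is arbitrary: uniqueness of limits forces every admissible
    \<open>D\<close> to agree with \<open>dir_deriv f\<close> on \<open>U\<close>.\<close>
  fix D u v
  assume "cont_derivative_on U f D" "u \<in> U"
  then show dir: "has_dir_deriv f u v (D u v)"
    using assms by (intro cont_derivative_on_has_dir_deriv)
  then show "D u v = dir_deriv f u v" by (rule dir_deriv_eqI[symmetric])
qed

end
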